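(* Let $\Omega$ be a finite non-empty set, let $\mathcal{D}=\{f_1,\dots,f_n\}$ be a finite set of gambles on $\Omega$, and choose any $\omega_0\in\Omega$. Then $\mathcal{D}$ avoids sure loss if and only if the optimal value of the following linear program (P2), in the real variables $\lambda_1,\dots,\lambda_n,\alpha$, is zero: $$\text{(P2)}\qquad \min\ \sum_{i=1}^{n}\lambda_i f_i(\omega_0)+\alpha$$ $$\text{subject to}\quad \forall \omega\in\Omega\setminus\{\omega_0\}\colon\ \sum_{i=1}^{n}\bigl(f_i(\omega_0)-f_i(\omega)\bigr)\lambda_i+\alpha\ge 0,\qquad \forall i\colon \lambda_i\ge 0,\quad \alpha\ge 0.$$ Equivalently, $\mathcal{D}$ avoids sure loss if and only if the dual problem (D2) of (P2), in the real variables $p(\omega)$, $\omega\in\Omega\setminus\{\omega_0\}$, has a feasible solution: $$\text{(D2)}\qquad \max\ 0$$ $$\text{subject to}\quad \forall f_i\in\mathcal{D}\colon\ \sum_{\omega\neq\omega_0}\bigl(f_i(\omega_0)-f_i(\omega)\bigr)p(\omega)\le f_i(\omega_0),\qquad \sum_{\omega\neq\omega_0}p(\omega)\le 1,\qquad \forall\omega\neq\omega_0\colon p(\omega)\ge 0.$$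
   Context: $\Omega$ is a finite (non-empty) set of outcomes. A gamble is a bounded real-valued function on $\Omega$; $\mathcal{L}(\Omega)$ denotes the set of all gambles. A set $\mathcal{D}\subseteq\mathcal{L}(\Omega)$ avoids sure loss if for all $n\in\mathbb{N}$, all $\lambda_1,\dots,\lambda_n\ge 0$ and all $f_1,\dots,f_n\in\mathcal{D}$, $\max_{\omega\in\Omega}\left(\sum_{i=1}^{n}\lambda_i f_i(\omega)\right)\ge 0$. A solution (assignment of the variables) of a linear program is feasible if it satisfies all constraints. The optimal value of a minimisation problem is the infimum of the objective function over the feasible solutions (it is $-\infty$ if the problem is unbounded). *)

theory Defs
  imports "HOL-Analysis.Analysis"
begin

text \<open>
  Outcomes form a set \<open>\<Omega>\<close> inside an ambient type; only the values of a gamble on \<open>\<Omega>\<close> matter.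
\<close>

definition gambles :: "'w set \<Rightarrow> ('w \<Rightarrow> real) set" where
  "gambles \<Omega> = {f. bounded (f ` \<Omega>)}"

text \<open>The maximum is the intended one for finite non-empty \<open>\<Omega>\<close> only.\<close>

definition avoids_sure_loss :: "'w set \<Rightarrow> ('w \<Rightarrow> real) set \<Rightarrow> bool" where
  "avoids_sure_loss \<Omega> D \<longleftrightarrow>
     (\<forall>(n::nat) (l :: nat \<Rightarrow> real) (g :: nat \<Rightarrow> 'w \<Rightarrow> real).
        (\<forall>i\<in>{1..n}. 0 \<le> l i \<and> g i \<in> D) \<longrightarrow>
        0 \<le> (MAX \<omega>\<in>\<Omega>. \<Sum>i=1..n. l i * g i \<omega>))"

text \<open>
  The value lies in the extended reals: it is \<open>-\<infinity>\<close> for an unbounded program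
  and \<open>\<infinity>\<close> for an infeasible one.
\<close>

definition min_value :: "('x \<Rightarrow> bool) \<Rightarrow> ('x \<Rightarrow> real) \<Rightarrow> ereal" where
  "min_value feasible objective = (INF x\<in>{x. feasible x}. ereal (objective x))"

text \<open>
  A solution of (P2) is a pair of \<open>\<lambda>\<close> (written \<open>l\<close>, relevant on \<open>{1..n}\<close> only) and \<open>\<alpha>\<close>.
\<close>

definition P2_objective ::
  "nat \<Rightarrow> (nat \<Rightarrow> 'w \<Rightarrow> real) \<Rightarrow> 'w \<Rightarrow> (nat \<Rightarrow> real) \<times> real \<Rightarrow> real" where
  "P2_objective n f \<omega>0 = (\<lambda>(l, \<alpha>). (\<Sum>i=1..n. l i * f i \<omega>0) + \<alpha>)"

definition P2_feasible ::
  "'w set \<Rightarrow> nat \<Rightarrow> (nat \<Rightarrow> 'w \<Rightarrow> real) \<Rightarrow> 'w \<Rightarrow> (nat \<Rightarrow> real) \<times> real \<Rightarrow> bool" where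
  "P2_feasible \<Omega> n f \<omega>0 = (\<lambda>(l, \<alpha>).
     (\<forall>\<omega>\<in>\<Omega> - {\<omega>0}. (\<Sum>i=1..n. (f i \<omega>0 - f i \<omega>) * l i) + \<alpha> \<ge> 0) \<and>
     (\<forall>i\<in>{1..n}. l i \<ge> 0) \<and> \<alpha> \<ge> 0)"

definition P2_value :: "'w set \<Rightarrow> nat \<Rightarrow> (nat \<Rightarrow> 'w \<Rightarrow> real) \<Rightarrow> 'w \<Rightarrow> ereal" where
  "P2_value \<Omega> n f \<omega>0 = min_value (P2_feasible \<Omega> n f \<omega>0) (P2_objective n f \<omega>0)"

text \<open>The objective of (D2) is constantly zero.\<close>

definition D2_feasible ::
  "'w set \<Rightarrow> nat \<Rightarrow> (nat \<Rightarrow> 'w \<Rightarrow> real) \<Rightarrow> 'w \<Rightarrow> ('w \<Rightarrow> real) \<Rightarrow> bool" where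
  "D2_feasible \<Omega> n f \<omega>0 p \<longleftrightarrow>
     (\<forall>i\<in>{1..n}. (\<Sum>\<omega>\<in>\<Omega> - {\<omega>0}. (f i \<omega>0 - f i \<omega>) * p \<omega>) \<le> f i \<omega>0) \<and>
     (\<Sum>\<omega>\<in>\<Omega> - {\<omega>0}. p \<omega>) \<le> 1 \<and>
     (\<forall>\<omega>\<in>\<Omega> - {\<omega>0}. p \<omega> \<ge> 0)"

text \<open>
  The lemmas below confirm that (D2) is the dual of (P2), for the usual symmetric pair of programs
  \<open>min c x\<close> subject to \<open>A x \<ge> b\<close>, \<open>x \<ge> 0\<close>, and \<open>max b y\<close> subject to \<open>A\<^sup>T y \<le> c\<close>, \<open>y \<ge> 0\<close>,
  with variables indexed by \<open>V\<close> and constraints by \<open>K\<close>. In (P2) the index \<open>None\<close> belongs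
  to \<open>\<alpha>\<close>, and \<open>Some i\<close> to the \<open>i\<close>-th multiplier; the right-hand side is zero.
\<close>

definition primal_feasible ::
  "'v set \<Rightarrow> 'k set \<Rightarrow> ('k \<Rightarrow> 'v \<Rightarrow> real) \<Rightarrow> ('k \<Rightarrow> real) \<Rightarrow> ('v \<Rightarrow> real) \<Rightarrow> bool" where
  "primal_feasible V K A b x \<longleftrightarrow>
     (\<forall>k\<in>K. (\<Sum>v\<in>V. A k v * x v) \<ge> b k) \<and> (\<forall>v\<in>V. x v \<ge> 0)"

definition dual_feasible ::
  "'v set \<Rightarrow> 'k set \<Rightarrow> ('k \<Rightarrow> 'v \<Rightarrow> real) \<Rightarrow> ('v \<Rightarrow> real) \<Rightarrow> ('k \<Rightarrow> real) \<Rightarrow> bool" where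
  "dual_feasible V K A c y \<longleftrightarrow>
     (\<forall>v\<in>V. (\<Sum>k\<in>K. A k v * y k) \<le> c v) \<and> (\<forall>k\<in>K. y k \<ge> 0)"

definition P2_vars :: "nat \<Rightarrow> nat option set" where
  "P2_vars n = insert None (Some ` {1..n})"

definition P2_matrix ::
  "(nat \<Rightarrow> 'w \<Rightarrow> real) \<Rightarrow> 'w \<Rightarrow> 'w \<Rightarrow> nat option \<Rightarrow> real" where
  "P2_matrix f \<omega>0 \<omega> v = (case v of None \<Rightarrow> 1 | Some i \<Rightarrow> f i \<omega>0 - f i \<omega>)"

definition P2_cost :: "(nat \<Rightarrow> 'w \<Rightarrow> real) \<Rightarrow> 'w \<Rightarrow> nat option \<Rightarrow> real" where
  "P2_cost f \<omega>0 v = (case v of None \<Rightarrow> 1 | Some i \<Rightarrow> f i \<omega>0)"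

lemma sum_P2_vars: "sum h (P2_vars n) = h None + (\<Sum>i=1..n. h (Some i))"
  unfolding P2_vars_def by (simp add: sum.reindex)

lemma P2_objective_standard:
  "P2_objective n f \<omega>0 (l, \<alpha>) = (\<Sum>v\<in>P2_vars n. P2_cost f \<omega>0 v * case_option \<alpha> l v)"
  by (simp add: P2_objective_def sum_P2_vars P2_cost_def mult.commute)

lemma P2_feasible_standard:
  "P2_feasible \<Omega> n f \<omega>0 (l, \<alpha>) \<longleftrightarrow>
     primal_feasible (P2_vars n) (\<Omega> - {\<omega>0}) (P2_matrix f \<omega>0) (\<lambda>\<omega>. 0) (case_option \<alpha> l)"
  unfolding P2_feasible_def primal_feasible_def sum_P2_vars P2_matrix_def
  by (auto simp: P2_vars_def add.commute)

lemma D2_feasible_dual: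
  "D2_feasible \<Omega> n f \<omega>0 p \<longleftrightarrow>
     dual_feasible (P2_vars n) (\<Omega> - {\<omega>0}) (P2_matrix f \<omega>0) (P2_cost f \<omega>0) p"
  unfolding D2_feasible_def dual_feasible_def P2_matrix_def P2_cost_def
  by (auto simp: P2_vars_def)

end

theory Submission
  imports Defs
begin

text \<open>
  All three conditions are compared with one about plain multipliers: every nonnegative
  combination \<open>\<Sum>i. l i * f i\<close> is nonnegative at some outcome.

  For (P2), fix the multipliers. The smallest \<open>\<alpha>\<close> that the constraints admit is the
  amount by which the maximum of the combination exceeds its value at \<open>\<omega>0\<close>, so minimising over
  \<open>\<alpha>\<close> turns the objective into exactly that maximum. Since zero is a feasible point with
  objective zero, the value of (P2) is zero precisely when none of these maxima is negative.

  For (D2), put the mass missing from \<open>p\<close> on \<open>\<omega>0\<close>. The constraints then say that \<open>p\<close> is a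
  probability mass function under which every \<open>f i\<close> has nonnegative expectation. Such a \<open>p\<close>
  clearly excludes a uniformly negative combination. The converse
  (\<open>exists_mass_if_no_negative_combination\<close>) is a theorem of the alternative of Gordan and Ville,
  and the one step that needs an existence argument. Instead of a separating hyperplane, it takes a
  mass function that minimises the squared distance \<open>\<Sum>i. (min 0 (E f i))\<^sup>2\<close> of the vector of
  expectations from the nonnegative orthant; if this distance is positive, the deficits
  \<open>- min 0 (E f i)\<close> are multipliers of a uniformly negative combination.
\<close>

section \<open>The simplex of probability mass functions\<close>

definition mass_functions :: "'w set \<Rightarrow> ('w \<Rightarrow> real) set" where
  "mass_functions \<Omega> = {p. (\<forall>\<omega>\<in>\<Omega>. 0 \<le> p \<omega>) \<and> (\<forall>\<omega>. \<omega> \<notin> \<Omega> \<longrightarrow> p \<omega> = 0) \<and> sum p \<Omega> = 1}"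

text \<open>
  Pinning \<open>p\<close> to zero off \<open>\<Omega>\<close> makes the mass functions a closed subset of a product
  of compact sets, so that Tychonoff's theorem applies although the ambient type may be infinite.
\<close>
lemma compact_mass_functions:
  assumes "finite \<Omega>"
  shows "compact (mass_functions \<Omega>)"
proof -
  let ?K = "PiE UNIV (\<lambda>\<omega>. if \<omega> \<in> \<Omega> then {0..1::real} else {0})"
  have "compactin (product_topology (\<lambda>_. euclidean) UNIV) ?K"
    unfolding compactin_PiE by auto
  then have K: "compact ?K"
    by (simp add: euclidean_product_topology)
  have "continuous_on UNIV (\<lambda>p :: 'a \<Rightarrow> real. sum p \<Omega>)"
    by (intro continuous_on_sum continuous_on_product_coordinates)
  then have "closed {p :: 'a \<Rightarrow> real. sum p \<Omega> = 1}"
    by (intro closed_Collect_eq) auto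
  moreover have "mass_functions \<Omega> = ?K \<inter> {p. sum p \<Omega> = 1}"
  proof (intro equalityI subsetI)
    fix p assume p: "p \<in> mass_functions \<Omega>"
    then have "p \<omega> \<le> 1" if "\<omega> \<in> \<Omega>" for \<omega>
      using member_le_sum[of \<omega> \<Omega> p] that assms by (auto simp: mass_functions_def)
    with p show "p \<in> ?K \<inter> {p. sum p \<Omega> = 1}"
      by (auto simp: mass_functions_def)
  next
    fix p assume "p \<in> ?K \<inter> {p. sum p \<Omega> = 1}"
    then show "p \<in> mass_functions \<Omega>"
      by (auto simp: mass_functions_def PiE_iff split: if_splits)
  qed
  ultimately show ?thesis
    using K by (simp add: compact_Int_closed)
qed

lemma mass_functions_move_toward_outcome:
  assumes "finite \<Omega>" "p \<in> mass_functions \<Omega>" "\<omega> \<in> \<Omega>" "0 \<le> t" "t \<le> 1"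
  shows "(\<lambda>x. p x + t * (of_bool (x = \<omega>) - p x)) \<in> mass_functions \<Omega>"
proof -
  have eq: "p x + t * (of_bool (x = \<omega>) - p x) = (1 - t) * p x + t * of_bool (x = \<omega>)" for x
    by (simp add: algebra_simps)
  have "(\<Sum>x\<in>\<Omega>. (1 - t) * p x + t * of_bool (x = \<omega>)) = 1"
    using assms by (simp add: sum.distrib flip: sum_distrib_left) (simp add: mass_functions_def)
  then show ?thesis
    unfolding eq using assms by (auto simp: mass_functions_def)
qed

lemma expectation_move_toward_outcome:
  fixes p g :: "'w \<Rightarrow> real"
  assumes "finite \<Omega>" "\<omega> \<in> \<Omega>"
  shows "(\<Sum>x\<in>\<Omega>. (p x + t * (of_bool (x = \<omega>) - p x)) * g x) =
    (\<Sum>x\<in>\<Omega>. p x * g x) + t * (g \<omega> - (\<Sum>x\<in>\<Omega>. p x * g x))"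
proof -
  have "(\<Sum>x\<in>\<Omega>. of_bool (x = \<omega>) * g x) = g \<omega>"
    using assms by (simp add: of_bool_def if_distrib[of "\<lambda>b. b * _"] cong: if_cong)
  then show ?thesis
    by (simp add: distrib_right left_diff_distrib mult.assoc sum.distrib sum_subtractf
        flip: sum_distrib_left)
qed

section \<open>The theorem of the alternative\<close>

text \<open>
  A quadratic upper bound that touches \<open>(min 0 x)\<^sup>2\<close> at \<open>x = a\<close>; it replaces a derivative.
\<close>
lemma min_zero_square_le:
  fixes a b :: real
  shows "(min 0 (a + b))\<^sup>2 \<le> (min 0 a + b)\<^sup>2"
proof (cases "a + b < 0")
  case True
  then have "\<bar>min 0 (a + b)\<bar> \<le> \<bar>min 0 a + b\<bar>"
    by (simp add: min_def)
  then show ?thesis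
    by (rule abs_le_square_iff[THEN iffD1])
qed simp

text \<open>
  For small \<open>t\<close> the linear term dominates the quadratic one, so a negative \<open>M\<close> would make
  the sum negative.
\<close>
lemma linear_coefficient_nonneg:
  fixes M B :: real
  assumes "\<And>t. 0 < t \<Longrightarrow> t \<le> 1 \<Longrightarrow> 0 \<le> 2 * t * M + t\<^sup>2 * B" and "0 \<le> B"
  shows "0 \<le> M"
proof (rule ccontr)
  assume "\<not> 0 \<le> M"
  define t where "t = min 1 (- M / (B + 1))"
  have t: "0 < t" "t \<le> 1"
    using \<open>\<not> 0 \<le> M\<close> \<open>0 \<le> B\<close> by (auto simp: t_def divide_simps)
  have "t \<le> - M / (B + 1)"
    by (simp add: t_def)
  then have "t * (B + 1) \<le> - M"
    using \<open>0 \<le> B\<close> by (subst (asm) pos_le_divide_eq) auto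
  then have "2 * M + t * B < 0"
    using t \<open>\<not> 0 \<le> M\<close> by (simp add: algebra_simps)
  then have "t * (2 * M + t * B) < 0"
    using t by (simp add: mult_pos_neg)
  with assms(1)[OF t] show False
    by (simp add: algebra_simps power2_eq_square)
qed

text \<open>
  At a minimiser of the squared distance, moving mass toward an outcome \<open>\<omega>\<close> cannot help. To
  first order this says that the combination whose multipliers are the deficits is, at \<open>\<omega>\<close>, at most
  its own expectation, which is minus the squared distance. If the distance were positive, the
  combination would thus be negative everywhere.
\<close>
lemma exists_mass_if_no_negative_combination:
  fixes f :: "'i \<Rightarrow> 'w \<Rightarrow> real"
  assumes "finite \<Omega>" "\<Omega> \<noteq> {}" "finite I"
    and alternative: "\<And>l. (\<forall>i\<in>I. 0 \<le> l i) \<Longrightarrow> \<exists>\<omega>\<in>\<Omega>. 0 \<le> (\<Sum>i\<in>I. l i * f i \<omega>)"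
  shows "\<exists>p\<in>mass_functions \<Omega>. \<forall>i\<in>I. 0 \<le> (\<Sum>\<omega>\<in>\<Omega>. p \<omega> * f i \<omega>)"
proof -
  define E where "E p i = (\<Sum>\<omega>\<in>\<Omega>. p \<omega> * f i \<omega>)" for p i
  define \<phi> where "\<phi> p = (\<Sum>i\<in>I. (min 0 (E p i))\<^sup>2)" for p
  have "continuous_on UNIV \<phi>"
    unfolding \<phi>_def E_def
    by (intro continuous_intros continuous_on_product_coordinates)
  then have cont: "continuous_on (mass_functions \<Omega>) \<phi>"
    by (rule continuous_on_subset) simp
  obtain \<omega>1 where "\<omega>1 \<in> \<Omega>"
    using \<open>\<Omega> \<noteq> {}\<close> by auto
  then have "(\<lambda>\<omega>. of_bool (\<omega> = \<omega>1)) \<in> mass_functions \<Omega>"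
    using \<open>finite \<Omega>\<close> by (auto simp: mass_functions_def)
  then obtain p where p: "p \<in> mass_functions \<Omega>"
    and p_min: "\<And>q. q \<in> mass_functions \<Omega> \<Longrightarrow> \<phi> p \<le> \<phi> q"
    using continuous_attains_inf[OF compact_mass_functions[OF \<open>finite \<Omega>\<close>] _ cont] by blast
  define m where "m i = min 0 (E p i)" for i
  have first_order: "0 \<le> (\<Sum>i\<in>I. m i * (f i \<omega> - E p i))" if "\<omega> \<in> \<Omega>" for \<omega>
  proof (rule linear_coefficient_nonneg)
    fix t :: real assume t: "0 < t" "t \<le> 1"
    let ?q = "\<lambda>x. p x + t * (of_bool (x = \<omega>) - p x)"
    have "?q \<in> mass_functions \<Omega>"
      using mass_functions_move_toward_outcome[of \<Omega> p \<omega> t] \<open>finite \<Omega>\<close> p that t by simp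
    then have "\<phi> p \<le> \<phi> ?q"
      by (rule p_min)
    also have "\<dots> = (\<Sum>i\<in>I. (min 0 (E p i + t * (f i \<omega> - E p i)))\<^sup>2)"
      unfolding \<phi>_def E_def expectation_move_toward_outcome[OF \<open>finite \<Omega>\<close> that] ..
    also have "\<dots> \<le> (\<Sum>i\<in>I. (m i + t * (f i \<omega> - E p i))\<^sup>2)"
      unfolding m_def by (intro sum_mono min_zero_square_le)
    also have "\<dots> = \<phi> p + (2 * t * (\<Sum>i\<in>I. m i * (f i \<omega> - E p i))
        + t\<^sup>2 * (\<Sum>i\<in>I. (f i \<omega> - E p i)\<^sup>2))"
      unfolding \<phi>_def m_def
      by (simp add: power2_sum power_mult_distrib sum.distrib sum_distrib_left mult_ac)
    finally show "0 \<le> 2 * t * (\<Sum>i\<in>I. m i * (f i \<omega> - E p i))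
        + t\<^sup>2 * (\<Sum>i\<in>I. (f i \<omega> - E p i)\<^sup>2)"
      by simp
  qed (simp add: sum_nonneg)
  obtain \<omega> where \<omega>: "\<omega> \<in> \<Omega>" "0 \<le> (\<Sum>i\<in>I. - m i * f i \<omega>)"
    using alternative[of "\<lambda>i. - m i"] by (auto simp: m_def)
  have "(\<Sum>i\<in>I. m i * E p i) = \<phi> p"
    unfolding \<phi>_def m_def by (intro sum.cong) (auto simp: min_def power2_eq_square)
  with first_order[OF \<omega>(1)] \<omega>(2) have "\<phi> p \<le> 0"
    by (simp add: right_diff_distrib sum_subtractf sum_negf)
  moreover have "0 \<le> \<phi> p"
    by (simp add: \<phi>_def sum_nonneg)
  ultimately have "\<phi> p = 0"
    by simp
  then have "\<forall>i\<in>I. min 0 (E p i) = 0"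
    using \<open>finite I\<close> by (simp add: \<phi>_def sum_nonneg_eq_0_iff)
  with p show ?thesis
    unfolding E_def min_def by (metis linorder_le_cases)
qed

lemma exists_mass_iff_no_negative_combination:
  fixes f :: "'i \<Rightarrow> 'w \<Rightarrow> real"
  assumes "finite \<Omega>" "\<Omega> \<noteq> {}" "finite I"
  shows "(\<exists>p\<in>mass_functions \<Omega>. \<forall>i\<in>I. 0 \<le> (\<Sum>\<omega>\<in>\<Omega>. p \<omega> * f i \<omega>)) \<longleftrightarrow>
    (\<forall>l. (\<forall>i\<in>I. 0 \<le> l i) \<longrightarrow> (\<exists>\<omega>\<in>\<Omega>. 0 \<le> (\<Sum>i\<in>I. l i * f i \<omega>)))"
    (is "?mass \<longleftrightarrow> ?combinations")
proof
  assume ?mass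
  then obtain p where p: "p \<in> mass_functions \<Omega>"
    and E: "\<forall>i\<in>I. 0 \<le> (\<Sum>\<omega>\<in>\<Omega>. p \<omega> * f i \<omega>)"
    by blast
  have p_nonneg: "\<forall>\<omega>\<in>\<Omega>. 0 \<le> p \<omega>" and "sum p \<Omega> = 1"
    using p by (auto simp: mass_functions_def)
  show ?combinations
  proof (intro allI impI, rule ccontr)
    fix l assume l: "\<forall>i\<in>I. 0 \<le> l i" and "\<not> (\<exists>\<omega>\<in>\<Omega>. 0 \<le> (\<Sum>i\<in>I. l i * f i \<omega>))"
    then have neg: "\<forall>\<omega>\<in>\<Omega>. (\<Sum>i\<in>I. l i * f i \<omega>) < 0"
      by (simp add: not_le)
    obtain \<omega> where "\<omega> \<in> \<Omega>" "0 < p \<omega>"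
      using \<open>sum p \<Omega> = 1\<close> p_nonneg by (metis order_less_le sum.neutral zero_neq_one)
    then have "(\<Sum>\<omega>\<in>\<Omega>. p \<omega> * (\<Sum>i\<in>I. l i * f i \<omega>)) < (\<Sum>\<omega>\<in>\<Omega>. 0)"
      using \<open>finite \<Omega>\<close> neg p_nonneg
      by (intro sum_strict_mono_ex1) (auto intro: mult_nonneg_nonpos less_imp_le mult_pos_neg)
    moreover have "(\<Sum>\<omega>\<in>\<Omega>. p \<omega> * (\<Sum>i\<in>I. l i * f i \<omega>)) =
        (\<Sum>i\<in>I. l i * (\<Sum>\<omega>\<in>\<Omega>. p \<omega> * f i \<omega>))"
      by (simp add: sum_distrib_left mult.left_commute) (rule sum.swap)
    moreover have "0 \<le> (\<Sum>i\<in>I. l i * (\<Sum>\<omega>\<in>\<Omega>. p \<omega> * f i \<omega>))"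
      using l E by (intro sum_nonneg) simp
    ultimately show False
      by simp
  qed
next
  assume ?combinations
  then show ?mass
    using exists_mass_if_no_negative_combination[OF assms, of f] by blast
qed

section \<open>Sure loss and the two linear programs\<close>

text \<open>
  A combination may use a gamble repeatedly; adding up the coefficients that go with the same
  index gives a combination of the family \<open>f\<close> itself.
\<close>
lemma avoids_sure_loss_image_iff:
  fixes f :: "nat \<Rightarrow> 'w \<Rightarrow> real"
  assumes "finite \<Omega>" "\<Omega> \<noteq> {}"
  shows "avoids_sure_loss \<Omega> (f ` {1..n}) \<longleftrightarrow>
    (\<forall>l. (\<forall>i\<in>{1..n}. 0 \<le> l i) \<longrightarrow> (\<exists>\<omega>\<in>\<Omega>. 0 \<le> (\<Sum>i=1..n. l i * f i \<omega>)))"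
    (is "?asl \<longleftrightarrow> ?combinations")
proof -
  have Max_iff: "0 \<le> (MAX \<omega>\<in>\<Omega>. h \<omega>) \<longleftrightarrow> (\<exists>\<omega>\<in>\<Omega>. 0 \<le> h \<omega>)" for h :: "'w \<Rightarrow> real"
    using assms by (subst Max_ge_iff) auto
  show ?thesis
  proof
    assume ?asl
    then have asl: "\<exists>\<omega>\<in>\<Omega>. 0 \<le> (\<Sum>i=1..n. l i * g i \<omega>)"
      if "\<forall>i\<in>{1..n}. 0 \<le> l i \<and> g i \<in> f ` {1..n}" for l :: "nat \<Rightarrow> real" and g
      using that unfolding avoids_sure_loss_def Max_iff by simp
    show ?combinations
    proof (intro allI impI)
      fix l :: "nat \<Rightarrow> real" assume "\<forall>i\<in>{1..n}. 0 \<le> l i"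
      then show "\<exists>\<omega>\<in>\<Omega>. 0 \<le> (\<Sum>i=1..n. l i * f i \<omega>)"
        by (intro asl) simp
    qed
  next
    assume comb: ?combinations
    show ?asl
      unfolding avoids_sure_loss_def Max_iff
    proof (intro allI impI)
      fix m :: nat and l :: "nat \<Rightarrow> real" and g
      assume lg: "\<forall>i\<in>{1..m}. 0 \<le> l i \<and> g i \<in> f ` {1..n}"
      then have "\<forall>i\<in>{1..m}. \<exists>j\<in>{1..n}. g i = f j"
        by blast
      then obtain k where k: "\<And>i. i \<in> {1..m} \<Longrightarrow> k i \<in> {1..n} \<and> g i = f (k i)"
        by metis
      define c where "c j = (\<Sum>i\<in>{i\<in>{1..m}. k i = j}. l i)" for j
      have "(\<Sum>i=1..m. l i * g i \<omega>) = (\<Sum>j=1..n. c j * f j \<omega>)" for \<omega>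
      proof -
        have "(\<Sum>i=1..m. l i * g i \<omega>) = (\<Sum>i=1..m. l i * f (k i) \<omega>)"
          using k by (intro sum.cong) auto
        also have "\<dots> = (\<Sum>j=1..n. \<Sum>i\<in>{i\<in>{1..m}. k i = j}. l i * f (k i) \<omega>)"
          using k by (intro sum.group[symmetric]) auto
        also have "\<dots> = (\<Sum>j=1..n. c j * f j \<omega>)"
          unfolding c_def sum_distrib_right by (intro sum.cong) auto
        finally show ?thesis .
      qed
      moreover have "\<forall>j\<in>{1..n}. 0 \<le> c j"
        using lg by (auto simp: c_def intro!: sum_nonneg)
      ultimately show "\<exists>\<omega>\<in>\<Omega>. 0 \<le> (\<Sum>i=1..m. l i * g i \<omega>)"
        using comb by simp
    qed
  qed
qed

text \<open>The zero solution bounds the value above, so only the lower bound is at stake.\<close>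
lemma P2_value_eq_0_iff_nonneg:
  "P2_value \<Omega> n f \<omega>0 = 0 \<longleftrightarrow>
    (\<forall>x. P2_feasible \<Omega> n f \<omega>0 x \<longrightarrow> 0 \<le> P2_objective n f \<omega>0 x)"
proof -
  have "P2_feasible \<Omega> n f \<omega>0 (\<lambda>_. 0, 0)" "P2_objective n f \<omega>0 (\<lambda>_. 0, 0) = 0"
    by (auto simp: P2_feasible_def P2_objective_def)
  then have "P2_value \<Omega> n f \<omega>0 \<le> 0"
    unfolding P2_value_def min_value_def zero_ereal_def by (metis INF_lower mem_Collect_eq)
  then have "P2_value \<Omega> n f \<omega>0 = 0 \<longleftrightarrow> 0 \<le> P2_value \<Omega> n f \<omega>0"
    by auto
  then show ?thesis
    by (auto simp: P2_value_def min_value_def le_INF_iff)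
qed

lemma P2_value_eq_0_iff_no_negative_combination:
  assumes "finite \<Omega>" "\<omega>0 \<in> \<Omega>"
  shows "P2_value \<Omega> n f \<omega>0 = 0 \<longleftrightarrow>
    (\<forall>l. (\<forall>i\<in>{1..n}. 0 \<le> l i) \<longrightarrow> (\<exists>\<omega>\<in>\<Omega>. 0 \<le> (\<Sum>i=1..n. l i * f i \<omega>)))"
    (is "_ \<longleftrightarrow> ?combinations")
  unfolding P2_value_eq_0_iff_nonneg
proof
  let ?S = "\<lambda>l \<omega>. \<Sum>i=1..n. l i * f i \<omega>"
  have constraint: "(\<Sum>i=1..n. (f i \<omega>0 - f i \<omega>) * l i) = ?S l \<omega>0 - ?S l \<omega>" for l \<omega>
    by (simp add: right_diff_distrib sum_subtractf mult.commute)
  {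
    assume nonneg: "\<forall>x. P2_feasible \<Omega> n f \<omega>0 x \<longrightarrow> 0 \<le> P2_objective n f \<omega>0 x"
    show ?combinations
    proof (intro allI impI)
      fix l :: "nat \<Rightarrow> real" assume l: "\<forall>i\<in>{1..n}. 0 \<le> l i"
      \<comment> \<open>The least feasible \<open>\<alpha>\<close> for these multipliers; the objective becomes the maximum.\<close>
      define \<alpha> where "\<alpha> = (MAX \<omega>\<in>\<Omega>. ?S l \<omega>) - ?S l \<omega>0"
      have "?S l \<omega> \<le> (MAX \<omega>\<in>\<Omega>. ?S l \<omega>)" if "\<omega> \<in> \<Omega>" for \<omega>
        using assms(1) that by simp
      then have "P2_feasible \<Omega> n f \<omega>0 (l, \<alpha>)"
        using l assms(2) unfolding P2_feasible_def case_prod_conv constraint \<alpha>_def by simp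
      then have "0 \<le> P2_objective n f \<omega>0 (l, \<alpha>)"
        using nonneg by blast
      then have "0 \<le> (MAX \<omega>\<in>\<Omega>. ?S l \<omega>)"
        by (simp add: P2_objective_def \<alpha>_def)
      then show "\<exists>\<omega>\<in>\<Omega>. 0 \<le> ?S l \<omega>"
        using assms by (subst (asm) Max_ge_iff) auto
    qed
  next
    assume comb: ?combinations
    show "\<forall>x. P2_feasible \<Omega> n f \<omega>0 x \<longrightarrow> 0 \<le> P2_objective n f \<omega>0 x"
    proof (intro allI impI)
      fix x assume feasible: "P2_feasible \<Omega> n f \<omega>0 x"
      obtain l \<alpha> where x: "x = (l, \<alpha>)"
        by (cases x)
      have "\<forall>i\<in>{1..n}. 0 \<le> l i" and "0 \<le> \<alpha>"
        and row: "\<And>\<omega>. \<omega> \<in> \<Omega> - {\<omega>0} \<Longrightarrow> 0 \<le> ?S l \<omega>0 - ?S l \<omega> + \<alpha>"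
        using feasible unfolding x P2_feasible_def case_prod_conv constraint by auto
      then obtain \<omega> where "\<omega> \<in> \<Omega>" "0 \<le> ?S l \<omega>"
        using comb by blast
      moreover have "?S l \<omega> \<le> ?S l \<omega>0 + \<alpha>"
        using row[of \<omega>] \<open>\<omega> \<in> \<Omega>\<close> \<open>0 \<le> \<alpha>\<close> by (cases "\<omega> = \<omega>0") auto
      ultimately show "0 \<le> P2_objective n f \<omega>0 x"
        by (simp add: x P2_objective_def)
    qed
  }
qed

text \<open>
  The variable \<open>p \<omega>0\<close> is eliminated in (D2): it is the slack in \<open>(\<Sum>\<omega>\<noteq>\<omega>0. p \<omega>) \<le> 1\<close>.
\<close>
lemma ex_D2_feasible_iff_ex_mass:
  assumes "finite \<Omega>" "\<omega>0 \<in> \<Omega>"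
  shows "(\<exists>p. D2_feasible \<Omega> n f \<omega>0 p) \<longleftrightarrow>
    (\<exists>p\<in>mass_functions \<Omega>. \<forall>i\<in>{1..n}. 0 \<le> (\<Sum>\<omega>\<in>\<Omega>. p \<omega> * f i \<omega>))"
proof -
  let ?R = "\<Omega> - {\<omega>0}"
  have split: "sum h \<Omega> = h \<omega>0 + sum h ?R" for h :: "'a \<Rightarrow> real"
    using assms by (rule sum.remove)
  have expectation: "(\<Sum>\<omega>\<in>\<Omega>. p \<omega> * f i \<omega>) = f i \<omega>0 - (\<Sum>\<omega>\<in>?R. (f i \<omega>0 - f i \<omega>) * p \<omega>)"
    if "sum p \<Omega> = 1" for p i
  proof -
    have "p \<omega>0 = 1 - sum p ?R"
      using that split[of p] by simp
    then show ?thesis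
      by (simp add: split left_diff_distrib sum_subtractf sum_distrib_left mult.commute)
        (simp add: algebra_simps sum_distrib_left sum_subtractf)
  qed
  show ?thesis
  proof
    assume "\<exists>p. D2_feasible \<Omega> n f \<omega>0 p"
    then obtain p where p: "D2_feasible \<Omega> n f \<omega>0 p" ..
    define q where "q \<omega> = (if \<omega> = \<omega>0 then 1 - sum p ?R else if \<omega> \<in> \<Omega> then p \<omega> else 0)" for \<omega>
    have "sum q ?R = sum p ?R"
      by (intro sum.cong) (auto simp: q_def)
    then have q: "sum q \<Omega> = 1"
      by (simp add: split) (simp add: q_def)
    then have "q \<in> mass_functions \<Omega>"
      using p assms by (auto simp: mass_functions_def q_def D2_feasible_def)
    moreover have "(\<Sum>\<omega>\<in>?R. (f i \<omega>0 - f i \<omega>) * q \<omega>) = (\<Sum>\<omega>\<in>?R. (f i \<omega>0 - f i \<omega>) * p \<omega>)" for i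
      by (intro sum.cong) (auto simp: q_def)
    then have "\<forall>i\<in>{1..n}. 0 \<le> (\<Sum>\<omega>\<in>\<Omega>. q \<omega> * f i \<omega>)"
      using p by (simp add: expectation[OF q] D2_feasible_def)
    ultimately show "\<exists>p\<in>mass_functions \<Omega>. \<forall>i\<in>{1..n}. 0 \<le> (\<Sum>\<omega>\<in>\<Omega>. p \<omega> * f i \<omega>)"
      by blast
  next
    assume "\<exists>p\<in>mass_functions \<Omega>. \<forall>i\<in>{1..n}. 0 \<le> (\<Sum>\<omega>\<in>\<Omega>. p \<omega> * f i \<omega>)"
    then obtain p where "p \<in> mass_functions \<Omega>"
      and E: "\<forall>i\<in>{1..n}. 0 \<le> (\<Sum>\<omega>\<in>\<Omega>. p \<omega> * f i \<omega>)"
      by blast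
    then have p: "\<forall>\<omega>\<in>\<Omega>. 0 \<le> p \<omega>" "sum p \<Omega> = 1"
      by (auto simp: mass_functions_def)
    then have "sum p ?R \<le> 1"
      using split[of p] assms(2) by auto
    then have "D2_feasible \<Omega> n f \<omega>0 p"
      using p(1) E by (simp add: D2_feasible_def expectation[OF p(2)])
    then show "\<exists>p. D2_feasible \<Omega> n f \<omega>0 p"
      by blast
  qed
qed

theorem theorem6:
  fixes \<Omega> :: "'w set" and n :: nat and f :: "nat \<Rightarrow> 'w \<Rightarrow> real"
    and D :: "('w \<Rightarrow> real) set" and \<omega>0 :: 'w
  assumes "finite \<Omega>" and "\<Omega> \<noteq> {}"
    and "D \<subseteq> gambles \<Omega>" and "D = f ` {1..n}"
    and "\<omega>0 \<in> \<Omega>"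
  shows "(avoids_sure_loss \<Omega> D \<longleftrightarrow> P2_value \<Omega> n f \<omega>0 = 0) \<and>
         (avoids_sure_loss \<Omega> D \<longleftrightarrow> (\<exists>p. D2_feasible \<Omega> n f \<omega>0 p))"
  unfolding \<open>D = f ` {1..n}\<close> avoids_sure_loss_image_iff[OF assms(1,2)]
    P2_value_eq_0_iff_no_negative_combination[OF assms(1,5)]
    ex_D2_feasible_iff_ex_mass[OF assms(1,5)]
    exists_mass_iff_no_negative_combination[OF assms(1,2) finite_atLeastAtMost]
  by simp

end
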